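(* Let $D$ be a domain in $\mathbb{R}^N$, $N\geq2$, and let $K\geq 1$. (i) If $u:D\to[0,+\infty)$ is Lebesgue measurable and $u\in\mathcal{L}^1_{\mathrm{loc}}(D)$, then $u$ is $K$-quasi-nearly subharmonic if and only if $u$ is $K$-quasi-nearly subharmonic n.s., that is, if for all $\overline{B^N(x,r)}\subset D$, $$u(x)\leq\frac{K}{\nu_Nr^N}\int_{B^N(x,r)}u(y)\,dm_N(y).$$ (ii) If $u:D\to[-\infty,+\infty)$ is $K$-quasi-nearly subharmonic n.s., then $u$ is $K$-quasi-nearly subharmonic in $D$, but not necessarily conversely (the converse implication fails in general). (iii) A function $u:D\to[-\infty,+\infty)$ is $1$-quasi-nearly subharmonic if and only if it is nearly subharmonic, that is, it is $1$-quasi-nearly subharmonic n.s. (iv) If $u:D\to[0,+\infty)$ is quasi-nearly subharmonic and $\psi:[0,+\infty)\to[0,+\infty)$ is permissible, then $\psi\circ u$ is quasi-nearly subharmonic in $D$. (v) Harnack functions are quasi-nearly subharmonic.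
   Context: $m_N$ is Lebesgue measure on $\mathbb{R}^N$, $B^N(x,r)$ the open ball, $\nu_N=m_N(B^N(0,1))$, and $u^+=\max\{u,0\}$. Let $D\subset\mathbb{R}^N$ be a domain, $N\ge2$, and $K\geq1$. A Lebesgue measurable function $u:D\to[-\infty,+\infty)$ with $u^+\in\mathcal{L}^1_{\mathrm{loc}}(D)$ is: - nearly subharmonic if for all closed balls $\overline{B^N(x,r)}\subset D$, $u(x)\leq\frac{1}{\nu_N r^N}\int_{B^N(x,r)}u\,dm_N$; - $K$-quasi-nearly subharmonic if for all $M\geq 0$ and all $\overline{B^N(x,r)}\subset D$, $u_M(x)\leq\frac{K}{\nu_N r^N}\int_{B^N(x,r)}u_M\,dm_N$, where $u_M:=\max\{u,-M\}+M$; - $K$-quasi-nearly subharmonic n.s. (in the narrow sense) if for all $\overline{B^N(x,r)}\subset D$, $u(x)\leq\frac{K}{\nu_N r^N}\int_{B^N(x,r)}u\,dm_N$. It is quasi-nearly subharmonic if it is $K$-quasi-nearly subharmonic for some $K\geq1$. For $D\neq\mathbb{R}^N$, a continuous function $u:D\to[0,+\infty)$ is a Harnack function if there are constants $\lambda\in(0,1)$ and $C_\lambda\geq1$ such that $\max_{\overline{B^N(x,\lambda r)}}u\leq C_\lambda\min_{\overline{B^N(x,\lambda r)}}u$ whenever $\overline{B^N(x,r)}\subset D$. A function $\varphi:[0,+\infty)\to[0,+\infty)$ satisfies the $\Delta_2$-condition if there is a constant $C\geq1$ with $\varphi(2t)\leq C\varphi(t)$ for all $t\geq0$. A function $\psi:[0,+\infty)\to[0,+\infty)$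 is permissible if there exist an increasing (strictly or not), convex function $\psi_1:[0,+\infty)\to[0,+\infty)$ and a strictly increasing surjection $\psi_2:[0,+\infty)\to[0,+\infty)$ such that $\psi=\psi_2\circ\psi_1$, $\psi_1$ satisfies the $\Delta_2$-condition, $\psi_2^{-1}$ satisfies the $\Delta_2$-condition, and $t\mapsto\psi_2(t)/t$ is quasi-decreasing, i.e. there is $C>0$ with $\psi_2(s)/s\geq C\,\psi_2(t)/t$ for all $0<s\leq t$. *)

theory Defs
  imports "HOL-Analysis.Analysis"
begin

text \<open>
  A function \<open>D \<rightarrow> [-\<infinity>, +\<infinity>)\<close> is represented by a total function into
  \<^typ>\<open>ereal\<close> of which only the values on \<open>D\<close> matter.
\<close>

text \<open>
  The Lebesgue integral over \<open>A\<close> with values in the extended reals, meaningful when the integral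
  of the positive part is finite (or that of the negative part is).  All uses below are over balls
  with closure in \<open>D\<close>, where the positive part is integrable, so the \<open>\<infinity> - \<infinity>\<close>
  case never occurs and the value \<open>-\<infinity>\<close> is allowed.
\<close>
definition ext_integral :: "'a::euclidean_space set \<Rightarrow> ('a \<Rightarrow> ereal) \<Rightarrow> ereal" where
  "ext_integral A f =
     enn2ereal (\<integral>\<^sup>+x\<in>A. e2ennreal (max 0 (f x)) \<partial>lebesgue)
     - enn2ereal (\<integral>\<^sup>+x\<in>A. e2ennreal (max 0 (- f x)) \<partial>lebesgue)"

definition L1_loc :: "'a::euclidean_space set \<Rightarrow> ('a \<Rightarrow> ereal) \<Rightarrow> bool" where
  "L1_loc D f \<longleftrightarrow> f \<in> borel_measurable (lebesgue_on D) \<and>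
     (\<forall>C. compact C \<and> C \<subseteq> D \<longrightarrow> (\<integral>\<^sup>+x\<in>C. e2ennreal \<bar>f x\<bar> \<partial>lebesgue) < \<infinity>)"

definition admissible :: "'a::euclidean_space set \<Rightarrow> ('a \<Rightarrow> ereal) \<Rightarrow> bool" where
  "admissible D u \<longleftrightarrow> u \<in> borel_measurable (lebesgue_on D) \<and> (\<forall>x\<in>D. u x \<noteq> \<infinity>) \<and>
     L1_loc D (\<lambda>x. max (u x) 0)"

definition ball_const :: "'a::euclidean_space itself \<Rightarrow> real" where
  "ball_const _ = measure lebesgue (ball (0::'a) 1)"

definition nearly_subharmonic :: "'a::euclidean_space set \<Rightarrow> ('a \<Rightarrow> ereal) \<Rightarrow> bool" where
  "nearly_subharmonic D u \<longleftrightarrow> admissible D u \<and>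
     (\<forall>x r. r > 0 \<and> cball x r \<subseteq> D \<longrightarrow>
        u x \<le> ereal (1 / (ball_const TYPE('a) * r ^ DIM('a))) * ext_integral (ball x r) u)"

definition trunc_shift :: "real \<Rightarrow> ('a \<Rightarrow> ereal) \<Rightarrow> 'a \<Rightarrow> ereal" where
  "trunc_shift M u x = max (u x) (ereal (- M)) + ereal M"

definition K_quasi_nearly_subharmonic ::
    "real \<Rightarrow> 'a::euclidean_space set \<Rightarrow> ('a \<Rightarrow> ereal) \<Rightarrow> bool" where
  "K_quasi_nearly_subharmonic K D u \<longleftrightarrow> admissible D u \<and>
     (\<forall>M x r. M \<ge> 0 \<and> r > 0 \<and> cball x r \<subseteq> D \<longrightarrow>
        trunc_shift M u x
          \<le> ereal (K / (ball_const TYPE('a) * r ^ DIM('a))) * ext_integral (ball x r) (trunc_shift M u))"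

definition K_quasi_nearly_subharmonic_ns ::
    "real \<Rightarrow> 'a::euclidean_space set \<Rightarrow> ('a \<Rightarrow> ereal) \<Rightarrow> bool" where
  "K_quasi_nearly_subharmonic_ns K D u \<longleftrightarrow> admissible D u \<and>
     (\<forall>x r. r > 0 \<and> cball x r \<subseteq> D \<longrightarrow>
        u x \<le> ereal (K / (ball_const TYPE('a) * r ^ DIM('a))) * ext_integral (ball x r) u)"

definition quasi_nearly_subharmonic :: "'a::euclidean_space set \<Rightarrow> ('a \<Rightarrow> ereal) \<Rightarrow> bool" where
  "quasi_nearly_subharmonic D u \<longleftrightarrow> (\<exists>K\<ge>1. K_quasi_nearly_subharmonic K D u)"

text \<open>
  The closed balls below are compact subsets of \<open>D\<close> (as \<open>lam < 1\<close>) and \<open>u\<close> is continuous,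
  so supremum and infimum are the maximum and minimum.
\<close>
definition Harnack_function :: "'a::euclidean_space set \<Rightarrow> ('a \<Rightarrow> real) \<Rightarrow> bool" where
  "Harnack_function D u \<longleftrightarrow> D \<noteq> UNIV \<and> continuous_on D u \<and> (\<forall>x\<in>D. u x \<ge> 0) \<and>
     (\<exists>lam C. 0 < lam \<and> lam < 1 \<and> C \<ge> 1 \<and>
        (\<forall>x r. r > 0 \<and> cball x r \<subseteq> D \<longrightarrow>
           (SUP y\<in>cball x (lam * r). u y) \<le> C * (INF y\<in>cball x (lam * r). u y)))"

text \<open>Functions \<open>[0,\<infinity>) \<rightarrow> [0,\<infinity>)\<close> are total real functions considered on \<^term>\<open>{0::real..}\<close> only.\<close>

definition Delta2 :: "(real \<Rightarrow> real) \<Rightarrow> bool" where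
  "Delta2 \<phi> \<longleftrightarrow> (\<exists>C\<ge>1. \<forall>t\<ge>0. \<phi> (2 * t) \<le> C * \<phi> t)"

definition permissible :: "(real \<Rightarrow> real) \<Rightarrow> bool" where
  "permissible \<psi> \<longleftrightarrow> \<psi> \<in> {0..} \<rightarrow> {0..} \<and>
     (\<exists>\<psi>1 \<psi>2.
        \<psi>1 \<in> {0..} \<rightarrow> {0..} \<and> mono_on {0..} \<psi>1 \<and> convex_on {0..} \<psi>1 \<and>
        strict_mono_on {0..} \<psi>2 \<and> \<psi>2 ` {0..} = {0..} \<and>
        (\<forall>t\<ge>0. \<psi> t = \<psi>2 (\<psi>1 t)) \<and>
        Delta2 \<psi>1 \<and> Delta2 (inv_into {0..} \<psi>2) \<and>
        (\<exists>C>0. \<forall>s t. 0 < s \<and> s \<le> t \<longrightarrow> \<psi>2 s / s \<ge> C * (\<psi>2 t / t)))"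

end

theory Submission
  imports Defs
begin

text \<open>
  Write \<open>u\<^sub>M = max u (-M) + M\<close> and let \<open>N\<close> be the dimension.

  The pointwise identity \<open>u\<^sub>M = u\<^sup>+ + M - min u\<^sup>- M\<close> expresses the integral of \<open>u\<^sub>M\<close> over a ball by
  finite quantities (\<open>ext_integral_trunc_shift\<close>).  As \<open>M \<le> K * M\<close>, the inequality for \<open>u\<close> implies
  that for \<open>u\<^sub>M\<close>; as \<open>u\<^sub>0 = u\<close> when \<open>u \<ge> 0\<close>, the two are equivalent for nonnegative functions.
  The constant \<open>-1\<close> shows that they differ in general when \<open>K > 1\<close>.  When \<open>K = 1\<close> the shift by \<open>M\<close> cancels,
  and monotone convergence as \<open>M\<close> tends to infinity recovers the inequality for \<open>u\<close>.

  For a permissible \<open>\<psi> = \<psi>2 \<circ> \<psi>1\<close>, note first that a nonnegative quasi-nearly subharmonic function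
  is locally bounded above, so that every composition with a nonnegative monotone function is locally
  integrable.  The convex part \<open>\<psi>1\<close> is handled by Jensen's inequality, where the doubling
  condition absorbs the factor \<open>K\<close> (\<open>quasi_submean_convex\<close>).  For \<open>\<psi>2\<close> Jensen's inequality points
  the wrong way; instead, the inequality for \<open>v = \<psi>1 \<circ> u\<close> is used in a small ball about an approximate
  maximum point of \<open>\<psi>2 \<circ> v\<close>, weighted by the \<open>N\<close>-th power of the distance to the boundary of
  the given ball (\<open>quasi_submean_quasi_decreasing\<close>).

  A Harnack function is bounded at \<open>x\<close> by a constant times each of its values in a smaller
  concentric ball, hence by a constant times its mean.
\<close>

section \<open>Integrals over balls\<close>

lemma ball_const_mult_power:
  fixes x :: "'a::euclidean_space"
  assumes "r > 0"
  shows "ball_const TYPE('a) * r ^ DIM('a) = measure lebesgue (ball x r)"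
  using content_ball[of r x] content_ball[of 1 "0::'a"] assms
  by (simp add: ball_const_def measure_completion)

lemma measure_ball_pos:
  fixes x :: "'a::euclidean_space"
  assumes "r > 0"
  shows "0 < measure lebesgue (ball x r)"
  using content_ball[of r x] assms by (simp add: measure_completion)

lemma measure_ball_scale:
  fixes x y :: "'a::euclidean_space"
  assumes "r > 0" "c > 0"
  shows "measure lebesgue (ball x (c * r)) = c ^ DIM('a) * measure lebesgue (ball y r)"
  using content_ball[of r y] content_ball[of "c * r" x] assms
  by (simp add: measure_completion power_mult_distrib)

lemma borel_measurable_times_indicator:
  fixes g :: "'a::euclidean_space \<Rightarrow> ennreal"
  assumes "g \<in> borel_measurable (lebesgue_on D)" "A \<in> sets lebesgue" "A \<subseteq> D"
  shows "(\<lambda>x. g x * indicator A x) \<in> borel_measurable lebesgue"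
proof -
  have "g \<in> borel_measurable (lebesgue_on A)"
    using assms measurable_restrict_mono by blast
  then show ?thesis
    using assms(2) by (subst (asm) borel_measurable_restrict_space_iff_ennreal) auto
qed

lemma ext_integral_cong:
  assumes "\<And>x. x \<in> A \<Longrightarrow> f x = g x"
  shows "ext_integral A f = ext_integral A g"
proof -
  have "(\<integral>\<^sup>+x\<in>A. e2ennreal (max 0 (f x)) \<partial>lebesgue) = (\<integral>\<^sup>+x\<in>A. e2ennreal (max 0 (g x)) \<partial>lebesgue)"
    and "(\<integral>\<^sup>+x\<in>A. e2ennreal (max 0 (- f x)) \<partial>lebesgue) = (\<integral>\<^sup>+x\<in>A. e2ennreal (max 0 (- g x)) \<partial>lebesgue)"
    using assms by (auto intro!: nn_integral_cong simp: indicator_def)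
  then show ?thesis
    by (simp add: ext_integral_def)
qed

lemma ext_integral_nonneg:
  assumes "\<And>x. x \<in> A \<Longrightarrow> 0 \<le> f x"
  shows "ext_integral A f = enn2ereal (\<integral>\<^sup>+x\<in>A. e2ennreal (f x) \<partial>lebesgue)"
proof -
  have "(\<integral>\<^sup>+x\<in>A. e2ennreal (max 0 (f x)) \<partial>lebesgue) = (\<integral>\<^sup>+x\<in>A. e2ennreal (f x) \<partial>lebesgue)"
    using assms by (auto intro!: nn_integral_cong simp: indicator_def)
  moreover have "(\<integral>\<^sup>+x\<in>A. e2ennreal (max 0 (- f x)) \<partial>lebesgue) = (\<integral>\<^sup>+x. 0 \<partial>(lebesgue :: 'a measure))"
    using assms by (intro nn_integral_cong) (auto simp: indicator_def max_def e2ennreal_neg ereal_uminus_le_0_iff)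
  ultimately show ?thesis
    by (simp add: ext_integral_def zero_ennreal.rep_eq)
qed

lemma ext_integral_ereal:
  fixes u :: "'a::euclidean_space \<Rightarrow> real"
  assumes "set_integrable lebesgue A u" "\<And>x. x \<in> A \<Longrightarrow> 0 \<le> u x"
  shows "ext_integral A (\<lambda>x. ereal (u x)) = ereal (LINT x:A|lebesgue. u x)"
proof -
  have "(\<integral>\<^sup>+x\<in>A. e2ennreal (ereal (u x)) \<partial>lebesgue) = (\<integral>\<^sup>+x. ennreal (indicator A x *\<^sub>R u x) \<partial>lebesgue)"
    by (intro nn_integral_cong) (auto simp: indicator_def)
  also have "\<dots> = ennreal (LINT x:A|lebesgue. u x)"
    unfolding set_lebesgue_integral_def using assms
    by (intro nn_integral_eq_integral) (auto simp: set_integrable_def indicator_def)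
  finally have eq: "(\<integral>\<^sup>+x\<in>A. e2ennreal (ereal (u x)) \<partial>lebesgue) = ennreal (LINT x:A|lebesgue. u x)" .
  have "0 \<le> (LINT x:A|lebesgue. u x)"
    using assms(2) by (simp add: set_lebesgue_integral_def integral_nonneg indicator_def)
  with eq show ?thesis
    using assms(2) by (subst ext_integral_nonneg) auto
qed

lemma L1_loc_set_integrable:
  fixes u :: "'a::euclidean_space \<Rightarrow> real"
  assumes "L1_loc D (\<lambda>x. ereal (u x))" "open D" "compact C" "C \<subseteq> D"
  shows "set_integrable lebesgue C u"
proof -
  have C: "C \<in> sets lebesgue"
    using \<open>compact C\<close> lmeasurable_compact by blast
  have "(\<lambda>x. ereal (u x)) \<in> borel_measurable (lebesgue_on D)"
    using assms(1) by (simp add: L1_loc_def)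
  then have "u \<in> borel_measurable (lebesgue_on D)"
    using borel_measurable_ereal_iff by blast
  then have "u \<in> borel_measurable (lebesgue_on C)"
    using \<open>C \<subseteq> D\<close> measurable_restrict_mono by blast
  then have "(\<lambda>x. indicator C x *\<^sub>R u x) \<in> borel_measurable lebesgue"
    using C by (subst (asm) borel_measurable_restrict_space_iff) auto
  moreover have "(\<integral>\<^sup>+x. ennreal (norm (indicator C x *\<^sub>R u x)) \<partial>lebesgue)
      = (\<integral>\<^sup>+x\<in>C. e2ennreal \<bar>ereal (u x)\<bar> \<partial>lebesgue)"
    by (intro nn_integral_cong) (auto simp: indicator_def)
  moreover have "(\<integral>\<^sup>+x\<in>C. e2ennreal \<bar>ereal (u x)\<bar> \<partial>lebesgue) < \<infinity>"
    using assms by (simp add: L1_loc_def)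
  ultimately show ?thesis
    unfolding set_integrable_def by (intro integrableI_bounded) auto
qed

lemma L1_loc_set_integrable_ball:
  fixes u :: "'a::euclidean_space \<Rightarrow> real"
  assumes "L1_loc D (\<lambda>x. ereal (u x))" "open D" "cball x r \<subseteq> D"
  shows "set_integrable lebesgue (ball x r) u"
  by (rule set_integrable_subset[OF L1_loc_set_integrable[OF assms(1,2) compact_cball assms(3)]]) auto

lemma locally_bounded_imp_L1_loc:
  fixes u :: "'a::euclidean_space \<Rightarrow> real"
  assumes "u \<in> borel_measurable (lebesgue_on D)"
    and "\<And>C. compact C \<Longrightarrow> C \<subseteq> D \<Longrightarrow> \<exists>B. \<forall>x\<in>C. \<bar>u x\<bar> \<le> B"
  shows "L1_loc D (\<lambda>x. ereal (u x))"
  unfolding L1_loc_def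
proof (intro conjI allI impI)
  show "(\<lambda>x. ereal (u x)) \<in> borel_measurable (lebesgue_on D)"
    using assms(1) by simp
next
  fix C assume C: "compact C \<and> C \<subseteq> D"
  with assms(2)[of C] obtain B where B: "\<And>x. x \<in> C \<Longrightarrow> \<bar>u x\<bar> \<le> B"
    by auto
  have "(\<integral>\<^sup>+x\<in>C. e2ennreal \<bar>ereal (u x)\<bar> \<partial>lebesgue) \<le> (\<integral>\<^sup>+x. ennreal B * indicator C x \<partial>lebesgue)"
  proof (rule nn_integral_mono)
    fix x
    show "e2ennreal \<bar>ereal (u x)\<bar> * indicator C x \<le> ennreal B * indicator C x"
      using B[of x] by (cases "x \<in> C") (simp_all add: ennreal_leI)
  qed
  also have "\<dots> = ennreal B * emeasure lebesgue C"
    using C lmeasurable_compact by (intro nn_integral_cmult_indicator) blast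
  also have "\<dots> < \<infinity>"
    using C lmeasurable_compact[of C] by (auto simp: ennreal_mult_less_top fmeasurable_def)
  finally show "(\<integral>\<^sup>+x\<in>C. e2ennreal \<bar>ereal (u x)\<bar> \<partial>lebesgue) < \<infinity>" .
qed

section \<open>Truncations\<close>

lemma ext_integral_eq_diff:
  assumes "(\<integral>\<^sup>+x\<in>A. e2ennreal (max 0 (u x)) \<partial>lebesgue) = ennreal p" "p \<ge> 0"
  shows "ext_integral A u = ereal p - enn2ereal (\<integral>\<^sup>+x\<in>A. e2ennreal (max 0 (- u x)) \<partial>lebesgue)"
  using assms by (simp add: ext_integral_def)

text \<open>
  This is the pointwise identity \<open>u\<^sub>M + min u\<^sup>- M = u\<^sup>+ + M\<close>, integrated; every term in it is
  finite and nonnegative, even where \<open>u = -\<infinity>\<close>.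
\<close>
lemma ext_integral_trunc_shift:
  fixes u :: "'a::euclidean_space \<Rightarrow> ereal" and M :: real
  assumes u: "u \<in> borel_measurable (lebesgue_on D)" "\<And>x. x \<in> D \<Longrightarrow> u x \<noteq> \<infinity>"
    and A: "A \<in> lmeasurable" "A \<subseteq> D" and M: "M \<ge> 0"
    and P: "(\<integral>\<^sup>+x\<in>A. e2ennreal (max 0 (u x)) \<partial>lebesgue) = ennreal p" "p \<ge> 0"
    and Q: "(\<integral>\<^sup>+x\<in>A. min (e2ennreal (max 0 (- u x))) (ennreal M) \<partial>lebesgue) = ennreal q" "q \<ge> 0"
  shows "ext_integral A (trunc_shift M u) = ereal (p - q + M * measure lebesgue A)"
    and "p - q + M * measure lebesgue A \<ge> 0"
proof -
  define T where "T = (\<integral>\<^sup>+x\<in>A. e2ennreal (trunc_shift M u x) \<partial>lebesgue)"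
  have nonneg: "0 \<le> trunc_shift M u x" if "x \<in> A" for x
  proof -
    have "ereal (- M) + ereal M \<le> trunc_shift M u x"
      unfolding trunc_shift_def by (intro add_right_mono) auto
    then show ?thesis by (simp add: zero_ereal_def)
  qed
  have As: "A \<in> sets lebesgue" using A(1) by auto
  have pw: "e2ennreal (trunc_shift M u x) + min (e2ennreal (max 0 (- u x))) (ennreal M)
      = e2ennreal (max 0 (u x)) + ennreal M" if "x \<in> A" for x
  proof (cases "u x")
    case (real a)
    consider "a \<ge> 0" | "-M \<le> a" "a \<le> 0" | "a \<le> - M" using M by linarith
    then show ?thesis
      using M real
      by cases (auto simp: trunc_shift_def max_def min_def ennreal_neg zero_ereal_def
          simp flip: ennreal_plus)
  next
    case MInf
    then show ?thesis using M by (simp add: trunc_shift_def zero_ereal_def[symmetric])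
  next
    case PInf
    then show ?thesis using u(2)[of x] that A(2) by auto
  qed
  have [measurable]: "trunc_shift M u \<in> borel_measurable (lebesgue_on D)"
    unfolding trunc_shift_def[abs_def] using u(1) by measurable
  note [measurable] = u(1)
  have "T + ennreal q = (\<integral>\<^sup>+x. e2ennreal (trunc_shift M u x) * indicator A x +
      min (e2ennreal (max 0 (- u x))) (ennreal M) * indicator A x \<partial>lebesgue)"
    unfolding T_def Q(1)[symmetric]
    by (subst nn_integral_add)
      (use As A(2) in \<open>auto intro!: borel_measurable_times_indicator[of _ D]\<close>)
  also have "\<dots> = (\<integral>\<^sup>+x. e2ennreal (max 0 (u x)) * indicator A x + ennreal M * indicator A x \<partial>lebesgue)"
    using pw by (intro nn_integral_cong) (auto simp: indicator_def)
  also have "\<dots> = ennreal p + ennreal M * emeasure lebesgue A"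
    unfolding P(1)[symmetric]
    using As A(2) nn_integral_cmult_indicator[OF As, of "ennreal M"]
    by (subst nn_integral_add) (simp_all add: borel_measurable_times_indicator[of _ D])
  also have "\<dots> = ennreal (p + M * measure lebesgue A)"
    using A(1) M P(2) by (simp add: emeasure_eq_measure2 ennreal_mult)
  finally have T: "T + ennreal q = ennreal (p + M * measure lebesgue A)" .
  then obtain t where t: "T = ennreal t" "t \<ge> 0"
    by (cases T) auto
  have "t + q = p + M * measure lebesgue A"
    using T t Q(2) P(2) M by (simp flip: ennreal_plus)
  then have t': "t = p - q + M * measure lebesgue A" by simp
  show "ext_integral A (trunc_shift M u) = ereal (p - q + M * measure lebesgue A)"
    using t unfolding t'[symmetric] by (subst ext_integral_nonneg) (auto simp: nonneg T_def)
  show "p - q + M * measure lebesgue A \<ge> 0"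
    using t t' by simp
qed

lemma admissible_positive_part_integral:
  fixes u :: "'a::euclidean_space \<Rightarrow> ereal"
  assumes "admissible D u" "cball x r \<subseteq> D"
  obtains p where "(\<integral>\<^sup>+y\<in>ball x r. e2ennreal (max 0 (u y)) \<partial>lebesgue) = ennreal p" "p \<ge> 0"
proof -
  have "(\<integral>\<^sup>+y\<in>ball x r. e2ennreal (max 0 (u y)) \<partial>lebesgue)
      \<le> (\<integral>\<^sup>+y\<in>cball x r. e2ennreal \<bar>max (u y) 0\<bar> \<partial>lebesgue)"
    by (intro nn_integral_mono) (auto simp: indicator_def max.commute)
  also have "\<dots> < \<infinity>"
    using assms by (simp add: admissible_def L1_loc_def)
  finally show thesis
    using that by (cases "\<integral>\<^sup>+y\<in>ball x r. e2ennreal (max 0 (u y)) \<partial>lebesgue") auto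
qed

lemma truncated_negative_part_integral:
  fixes u :: "'a::euclidean_space \<Rightarrow> ereal" and M :: real
  assumes "A \<in> lmeasurable"
  obtains q where "(\<integral>\<^sup>+y\<in>A. min (e2ennreal (max 0 (- u y))) (ennreal M) \<partial>lebesgue) = ennreal q" "q \<ge> 0"
proof -
  have "(\<integral>\<^sup>+y\<in>A. min (e2ennreal (max 0 (- u y))) (ennreal M) \<partial>lebesgue)
      \<le> (\<integral>\<^sup>+y. ennreal M * indicator A y \<partial>lebesgue)"
    by (intro nn_integral_mono) (auto simp: indicator_def)
  also have "\<dots> = ennreal M * emeasure lebesgue A"
    using assms by (intro nn_integral_cmult_indicator) auto
  also have "\<dots> < \<infinity>"
    using assms by (auto simp: ennreal_mult_less_top fmeasurable_def)
  finally show thesis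
    using that by (cases "\<integral>\<^sup>+y\<in>A. min (e2ennreal (max 0 (- u y))) (ennreal M) \<partial>lebesgue") auto
qed

text \<open>
  Where \<open>u x \<le> -M\<close> the truncation vanishes.  Elsewhere the value at \<open>x\<close> is \<open>u x + M\<close>, which is at
  most \<open>K\<close> times the mean of \<open>u + M\<close>, because \<open>M \<le> K * M\<close>; and \<open>u + M \<le> u\<^sub>M\<close>.
\<close>
theorem narrow_sense_imp_quasi_nearly_subharmonic:
  fixes u :: "'a::euclidean_space \<Rightarrow> ereal"
  assumes ns: "K_quasi_nearly_subharmonic_ns K D u" and K: "K \<ge> 1"
  shows "K_quasi_nearly_subharmonic K D u"
  unfolding K_quasi_nearly_subharmonic_def
proof (intro conjI allI impI)
  show adm: "admissible D u"
    using ns by (simp add: K_quasi_nearly_subharmonic_ns_def)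
  fix M r :: real and x assume *: "0 \<le> M \<and> 0 < r \<and> cball x r \<subseteq> D"
  then have M: "M \<ge> 0" and r: "r > 0" and cb: "cball x r \<subseteq> D" by auto
  have b_sub: "ball x r \<subseteq> D" and xD: "x \<in> D" using cb r by auto
  let ?b = "measure lebesgue (ball x r)"
  have b: "?b > 0" by (rule measure_ball_pos[OF r])
  obtain p where P: "(\<integral>\<^sup>+y\<in>ball x r. e2ennreal (max 0 (u y)) \<partial>lebesgue) = ennreal p" "p \<ge> 0"
    by (rule admissible_positive_part_integral[OF adm cb])
  obtain q where Q: "(\<integral>\<^sup>+y\<in>ball x r. min (e2ennreal (max 0 (- u y))) (ennreal M) \<partial>lebesgue) = ennreal q" "q \<ge> 0"
    using truncated_negative_part_integral[of "ball x r" u M] by auto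
  have meas: "u \<in> borel_measurable (lebesgue_on D)" and fin: "\<And>y. y \<in> D \<Longrightarrow> u y \<noteq> \<infinity>"
    using adm by (auto simp: admissible_def)
  note T = ext_integral_trunc_shift[OF meas fin lmeasurable_ball b_sub M P Q, simplified]
  have ux: "u x \<le> ereal (K / ?b) * (ereal p - enn2ereal (\<integral>\<^sup>+y\<in>ball x r. e2ennreal (max 0 (- u y)) \<partial>lebesgue))"
    using ns r cb
    unfolding K_quasi_nearly_subharmonic_ns_def ball_const_mult_power[OF r, of x, symmetric]
      ext_integral_eq_diff[OF P, symmetric] by blast
  have Q_le: "ereal q \<le> enn2ereal (\<integral>\<^sup>+y\<in>ball x r. e2ennreal (max 0 (- u y)) \<partial>lebesgue)"
  proof -
    have "ennreal q \<le> (\<integral>\<^sup>+y\<in>ball x r. e2ennreal (max 0 (- u y)) \<partial>lebesgue)"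
      unfolding Q(1)[symmetric] by (intro nn_integral_mono mult_right_mono) auto
    then show ?thesis using Q(2) by (simp add: less_eq_ennreal.rep_eq)
  qed
  have "u x \<le> ereal (K / ?b) * (ereal p - ereal q)"
    using ux by (rule order_trans) (use K b Q_le in \<open>intro ereal_mult_left_mono ereal_minus_mono, auto\<close>)
  then have ux': "u x \<le> ereal (K / ?b * (p - q))" by simp
  have "M \<le> K * M" using K M by (simp add: mult_le_cancel_right1)
  have "trunc_shift M u x \<le> ereal (K / ?b * (p - q + M * ?b))"
  proof (cases "u x \<le> ereal (- M)")
    case True
    then have "trunc_shift M u x = 0" by (simp add: trunc_shift_def max_def zero_ereal_def)
    also have "0 \<le> ereal (K / ?b * (p - q + M * ?b))"
      using T(2) K b by (simp add: zero_ereal_def)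
    finally show ?thesis .
  next
    case False
    then have "trunc_shift M u x = u x + ereal M" by (simp add: trunc_shift_def max_def)
    also have "\<dots> \<le> ereal (K / ?b * (p - q)) + ereal (K * M)"
      using ux' \<open>M \<le> K * M\<close> by (intro add_mono) auto
    also have "\<dots> = ereal (K / ?b * (p - q + M * ?b))"
      using b by (simp add: field_simps)
    finally show ?thesis .
  qed
  then show "trunc_shift M u x
       \<le> ereal (K / (ball_const TYPE('a) * r ^ DIM('a))) * ext_integral (ball x r) (trunc_shift M u)"
    using r by (simp add: ball_const_mult_power[of r x] T(1))
qed

lemma SUP_min_ennreal_of_nat: "(SUP n. min x (ennreal (real n))) = x"
proof (cases x)
  case (real r)
  obtain n where "r \<le> real n" using real_arch_simple by blast
  then have "x \<le> min x (ennreal (real n))" using real by (simp add: ennreal_leI)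
  then show ?thesis
    by (intro antisym SUP_least) (auto intro: SUP_upper2)
next
  case top
  then show ?thesis by (simp add: ennreal_of_nat_eq_real_of_nat[symmetric] ennreal_SUP_of_nat_eq_top)
qed

text \<open>
  With \<open>K = 1\<close> the shift by \<open>M\<close> cancels on both sides, which leaves the submean inequality of
  \<open>max u (-M)\<close>; monotone convergence of the truncated negative parts then gives that of \<open>u\<close>.
\<close>
theorem one_quasi_nearly_subharmonic_imp_nearly_subharmonic:
  fixes u :: "'a::euclidean_space \<Rightarrow> ereal"
  assumes qns: "K_quasi_nearly_subharmonic 1 D u"
  shows "nearly_subharmonic D u"
  unfolding nearly_subharmonic_def
proof (intro conjI allI impI)
  show adm: "admissible D u"
    using qns by (simp add: K_quasi_nearly_subharmonic_def)
  fix x r assume *: "0 < r \<and> cball x r \<subseteq> D"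
  then have r: "r > 0" and cb: "cball x r \<subseteq> D" by auto
  have b_sub: "ball x r \<subseteq> D" and xD: "x \<in> D" using cb r by auto
  let ?b = "measure lebesgue (ball x r)"
  have b: "?b > 0" by (rule measure_ball_pos[OF r])
  obtain p where P: "(\<integral>\<^sup>+y\<in>ball x r. e2ennreal (max 0 (u y)) \<partial>lebesgue) = ennreal p" "p \<ge> 0"
    by (rule admissible_positive_part_integral[OF adm cb])
  have meas[measurable]: "u \<in> borel_measurable (lebesgue_on D)" and fin: "\<And>y. y \<in> D \<Longrightarrow> u y \<noteq> \<infinity>"
    using adm by (auto simp: admissible_def)
  define Q where "Q = (\<integral>\<^sup>+y\<in>ball x r. e2ennreal (max 0 (- u y)) \<partial>lebesgue)"
  have "u x \<le> ereal (1 / ?b) * (ereal p - enn2ereal Q)"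
  proof (cases "u x")
    case (real a)
    have Qn: "(\<integral>\<^sup>+y\<in>ball x r. min (e2ennreal (max 0 (- u y))) (ennreal (real n)) \<partial>lebesgue) \<le> ennreal (p - ?b * a)
        \<and> 0 \<le> p - ?b * a" for n
    proof -
      obtain q where q: "(\<integral>\<^sup>+y\<in>ball x r. min (e2ennreal (max 0 (- u y))) (ennreal (real n)) \<partial>lebesgue) = ennreal q" "q \<ge> 0"
        using truncated_negative_part_integral[of "ball x r" u "real n"] by auto
      note T = ext_integral_trunc_shift[OF meas fin lmeasurable_ball b_sub of_nat_0_le_iff P q, simplified]
      have "ereal (a + real n) \<le> trunc_shift (real n) u x"
        unfolding trunc_shift_def real plus_ereal.simps(1)[symmetric] by (intro add_right_mono) simp
      also have "\<dots> \<le> ereal (1 / ?b) * ext_integral (ball x r) (trunc_shift (real n) u)"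
        using qns r cb of_nat_0_le_iff[of n, where 'a=real]
        unfolding K_quasi_nearly_subharmonic_def ball_const_mult_power[OF r, of x, symmetric] by blast
      also have "\<dots> = ereal (1 / ?b * (p - q) + real n)"
        using b by (simp add: T(1) field_simps)
      finally have "a \<le> 1 / ?b * (p - q)" by simp
      then have "q \<le> p - ?b * a" using b by (simp add: field_simps)
      then show ?thesis using q by (auto intro: ennreal_leI)
    qed
    have "Q = (\<integral>\<^sup>+y. (SUP n. min (e2ennreal (max 0 (- u y))) (ennreal (real n)) * indicator (ball x r) y) \<partial>lebesgue)"
      unfolding Q_def by (intro nn_integral_cong) (simp add: SUP_min_ennreal_of_nat indicator_def)
    also have "\<dots> = (SUP n. \<integral>\<^sup>+y. min (e2ennreal (max 0 (- u y))) (ennreal (real n)) * indicator (ball x r) y \<partial>lebesgue)"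
    proof (intro nn_integral_monotone_convergence_SUP)
      show "incseq (\<lambda>n y. min (e2ennreal (max 0 (- u y))) (ennreal (real n)) * indicator (ball x r) y)"
        by (intro incseq_SucI le_funI mult_right_mono min.mono ennreal_leI) auto
      show "(\<lambda>y. min (e2ennreal (max 0 (- u y))) (ennreal (real n)) * indicator (ball x r) y)
          \<in> borel_measurable lebesgue" for n
        using b_sub by (intro borel_measurable_times_indicator[of _ D]) auto
    qed
    also have "\<dots> \<le> ennreal (p - ?b * a)"
      using Qn by (intro SUP_least) auto
    finally have "Q \<le> ennreal (p - ?b * a)" .
    then obtain q where q: "Q = ennreal q" "q \<ge> 0" "q \<le> p - ?b * a"
      using Qn by (cases Q) (auto simp: top_unique)
    then have "a \<le> 1 / ?b * (p - q)" using b by (simp add: field_simps)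
    then show ?thesis using real q by simp
  next
    case PInf
    then show ?thesis using fin[OF xD] by simp
  qed auto
  then show "u x \<le> ereal (1 / (ball_const TYPE('a) * r ^ DIM('a))) * ext_integral (ball x r) u"
    using r by (simp add: ball_const_mult_power[of r x] ext_integral_eq_diff[OF P] Q_def)
qed

lemma nearly_subharmonic_iff_narrow_sense:
  "nearly_subharmonic D u \<longleftrightarrow> K_quasi_nearly_subharmonic_ns 1 D u"
  by (simp add: nearly_subharmonic_def K_quasi_nearly_subharmonic_ns_def)

text \<open>
  The truncations of the constant \<open>-1\<close> are nonnegative constants, for which a factor
  \<open>K > 1\<close> only helps, whereas \<open>-1 \<le> K * (-1)\<close> fails.
\<close>
theorem quasi_nearly_subharmonic_not_narrow_sense:
  fixes D :: "'a::euclidean_space set"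
  assumes D: "open D" "D \<noteq> {}" and K: "K > 1"
  shows "\<exists>u. K_quasi_nearly_subharmonic K D u \<and> \<not> K_quasi_nearly_subharmonic_ns K D u"
proof (intro exI conjI)
  let ?u = "\<lambda>x::'a. ereal (- 1)"
  have int: "ext_integral A (\<lambda>x. ereal c) = ereal (c * measure lebesgue A)"
    if "c \<ge> 0" "A \<in> lmeasurable" for A :: "'a set" and c
    using that by (subst ext_integral_ereal)
      (auto simp: set_integrable_def set_lebesgue_integral_def fmeasurable_def)
  have adm: "admissible D ?u"
    by (simp add: admissible_def L1_loc_def max_def e2ennreal_neg)
  show "K_quasi_nearly_subharmonic K D ?u"
    unfolding K_quasi_nearly_subharmonic_def
  proof (intro conjI allI impI adm)
    fix M r :: real and x assume *: "0 \<le> M \<and> 0 < r \<and> cball x r \<subseteq> D"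
    define c where "c = max (- 1) (- M) + M"
    have c: "c \<ge> 0" by (simp add: c_def)
    have u: "trunc_shift M ?u = (\<lambda>x. ereal c)"
      by (rule ext) (simp add: trunc_shift_def c_def max_def)
    have "c \<le> K * c" using K c by (simp add: mult_le_cancel_right1)
    then show "trunc_shift M ?u x
         \<le> ereal (K / (ball_const TYPE('a) * r ^ DIM('a))) * ext_integral (ball x r) (trunc_shift M ?u)"
      using * measure_ball_pos[of r x] by (simp add: u ball_const_mult_power[of r x] int c)
  qed
  show "\<not> K_quasi_nearly_subharmonic_ns K D ?u"
  proof
    assume ns: "K_quasi_nearly_subharmonic_ns K D ?u"
    obtain x r where x: "r > 0" "cball x r \<subseteq> D"
      using D open_contains_cball by blast
    let ?b = "measure lebesgue (ball x r)"
    have "(\<integral>\<^sup>+y\<in>ball x r. 1 \<partial>lebesgue) = ennreal ?b"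
      by (simp add: emeasure_eq_measure2)
    then have "ext_integral (ball x r) ?u = ereal (- ?b)"
      by (simp add: ext_integral_def max_def e2ennreal_neg zero_ennreal.rep_eq)
    then have "ereal (- 1) \<le> ereal (K / ?b) * ereal (- ?b)"
      using ns x unfolding K_quasi_nearly_subharmonic_ns_def
        ball_const_mult_power[OF x(1), of x, symmetric] by metis
    then show False
      using K measure_ball_pos[OF x(1), of x] by simp
  qed
qed

section \<open>Nonnegative functions\<close>

text \<open>
  The submean inequality with factor \<open>K\<close> for a real function, with Bochner integrals over balls.
  For nonnegative locally integrable functions and \<open>K \<ge> 1\<close> it is equivalent to both notions of
  quasi-near subharmonicity.
\<close>
definition quasi_submean :: "real \<Rightarrow> 'a::euclidean_space set \<Rightarrow> ('a \<Rightarrow> real) \<Rightarrow> bool" where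
  "quasi_submean K D u \<longleftrightarrow> (\<forall>x r. r > 0 \<and> cball x r \<subseteq> D \<longrightarrow>
     u x \<le> K / measure lebesgue (ball x r) * (LINT y:ball x r|lebesgue. u y))"

lemma admissible_ereal_iff:
  fixes u :: "'a::euclidean_space \<Rightarrow> real"
  assumes "\<And>x. x \<in> D \<Longrightarrow> 0 \<le> u x"
  shows "admissible D (\<lambda>x. ereal (u x)) \<longleftrightarrow> L1_loc D (\<lambda>x. ereal (u x))"
proof -
  have max: "max (ereal (u x)) 0 = ereal (u x)" if "x \<in> D" for x
    using assms[OF that] by (simp add: max_def)
  have "(\<lambda>x. max (ereal (u x)) 0) \<in> borel_measurable (lebesgue_on D)
      \<longleftrightarrow> (\<lambda>x. ereal (u x)) \<in> borel_measurable (lebesgue_on D)"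
    using max by (intro measurable_cong) auto
  moreover have "(\<integral>\<^sup>+x\<in>C. e2ennreal \<bar>max (ereal (u x)) 0\<bar> \<partial>lebesgue) =
      (\<integral>\<^sup>+x\<in>C. e2ennreal \<bar>ereal (u x)\<bar> \<partial>lebesgue)" if "C \<subseteq> D" for C
    using max assms that by (intro nn_integral_cong) (auto simp: indicator_def subset_iff)
  ultimately show ?thesis
    by (auto simp: admissible_def L1_loc_def)
qed

lemma narrow_sense_iff_quasi_submean:
  fixes u :: "'a::euclidean_space \<Rightarrow> real"
  assumes "open D" and nonneg: "\<And>x. x \<in> D \<Longrightarrow> 0 \<le> u x"
  shows "K_quasi_nearly_subharmonic_ns K D (\<lambda>x. ereal (u x))
    \<longleftrightarrow> L1_loc D (\<lambda>x. ereal (u x)) \<and> quasi_submean K D u"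
proof -
  have "ereal (u x) \<le> ereal (K / (ball_const TYPE('a) * r ^ DIM('a))) * ext_integral (ball x r) (\<lambda>x. ereal (u x))
      \<longleftrightarrow> u x \<le> K / measure lebesgue (ball x r) * (LINT y:ball x r|lebesgue. u y)"
    if "L1_loc D (\<lambda>x. ereal (u x))" "r > 0" "cball x r \<subseteq> D" for x r
  proof -
    have "ext_integral (ball x r) (\<lambda>x. ereal (u x)) = ereal (LINT y:ball x r|lebesgue. u y)"
      using nonneg that(3) ball_subset_cball[of x r]
      by (intro ext_integral_ereal L1_loc_set_integrable_ball[OF that(1) \<open>open D\<close> that(3)]) blast
    then show ?thesis
      unfolding ball_const_mult_power[OF that(2), of x] by simp
  qed
  then show ?thesis
    unfolding K_quasi_nearly_subharmonic_ns_def quasi_submean_def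
    using admissible_ereal_iff[of D u] nonneg by metis
qed

lemma quasi_nearly_subharmonic_iff_narrow_sense:
  fixes u :: "'a::euclidean_space \<Rightarrow> real"
  assumes nonneg: "\<And>x. x \<in> D \<Longrightarrow> 0 \<le> u x" and K: "K \<ge> 1"
  shows "K_quasi_nearly_subharmonic K D (\<lambda>x. ereal (u x))
    \<longleftrightarrow> K_quasi_nearly_subharmonic_ns K D (\<lambda>x. ereal (u x))"
proof
  assume qns: "K_quasi_nearly_subharmonic K D (\<lambda>x. ereal (u x))"
  have trunc: "trunc_shift 0 (\<lambda>x. ereal (u x)) x = ereal (u x)" if "x \<in> D" for x
    using nonneg[OF that] by (simp add: trunc_shift_def max_def flip: zero_ereal_def)
  show "K_quasi_nearly_subharmonic_ns K D (\<lambda>x. ereal (u x))"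
    unfolding K_quasi_nearly_subharmonic_ns_def
  proof (intro conjI allI impI)
    fix x r assume *: "0 < r \<and> cball x r \<subseteq> D"
    then have "x \<in> D" "ball x r \<subseteq> D" by auto
    then have "ext_integral (ball x r) (trunc_shift 0 (\<lambda>x. ereal (u x))) = ext_integral (ball x r) (\<lambda>x. ereal (u x))"
      using trunc by (intro ext_integral_cong) auto
    then show "ereal (u x) \<le> ereal (K / (ball_const TYPE('a) * r ^ DIM('a))) * ext_integral (ball x r) (\<lambda>x. ereal (u x))"
      using qns * trunc[OF \<open>x \<in> D\<close>] unfolding K_quasi_nearly_subharmonic_def by (metis order_refl)
  qed (use qns in \<open>simp add: K_quasi_nearly_subharmonic_def\<close>)
qed (rule narrow_sense_imp_quasi_nearly_subharmonic[OF _ K])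

lemma quasi_nearly_subharmonicI:
  fixes u :: "'a::euclidean_space \<Rightarrow> real"
  assumes "open D" "\<And>x. x \<in> D \<Longrightarrow> 0 \<le> u x" "K \<ge> 1"
    "L1_loc D (\<lambda>x. ereal (u x))" "quasi_submean K D u"
  shows "quasi_nearly_subharmonic D (\<lambda>x. ereal (u x))"
  using assms quasi_nearly_subharmonic_iff_narrow_sense[of D u K] narrow_sense_iff_quasi_submean[of D u K]
  unfolding quasi_nearly_subharmonic_def by auto

lemma set_integrable_const:
  fixes c :: real
  assumes "A \<in> fmeasurable M"
  shows "set_integrable M A (\<lambda>x. c)"
  using assms by (simp add: set_integrable_def fmeasurable_def)

lemma set_integral_nonneg_on:
  fixes f :: "'a \<Rightarrow> real"
  assumes "\<And>x. x \<in> A \<Longrightarrow> 0 \<le> f x"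
  shows "0 \<le> (LINT x:A|M. f x)"
  unfolding set_lebesgue_integral_def using assms
  by (intro Bochner_Integration.integral_nonneg) (auto simp: indicator_def)

lemma set_integral_mono_subset:
  fixes f :: "'a \<Rightarrow> real"
  assumes "set_integrable M B f" "A \<in> sets M" "A \<subseteq> B" "\<And>x. x \<in> B \<Longrightarrow> 0 \<le> f x"
  shows "(LINT x:A|M. f x) \<le> (LINT x:B|M. f x)"
proof -
  have "set_integrable M A f"
    by (rule set_integrable_subset[OF assms(1-3)])
  then show ?thesis
    using assms unfolding set_lebesgue_integral_def set_integrable_def
    by (intro integral_mono) (auto simp: indicator_def)
qed

lemma quasi_submean_locally_bounded:
  fixes u :: "'a::euclidean_space \<Rightarrow> real"
  assumes "open D" and nonneg: "\<And>x. x \<in> D \<Longrightarrow> 0 \<le> u x" and "K \<ge> 0"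
    and L1: "L1_loc D (\<lambda>x. ereal (u x))" and sm: "quasi_submean K D u"
    and C: "compact C" "C \<subseteq> D"
  shows "\<exists>B. \<forall>x\<in>C. u x \<le> B"
proof -
  obtain e where e: "e > 0" "(\<Union>x\<in>C. cball x e) \<subseteq> D"
    using compact_subset_open_imp_cball_epsilon_subset[OF C(1) \<open>open D\<close> C(2)] by blast
  define E where "E = {x + y | x y. x \<in> C \<and> y \<in> cball 0 e}"
  have cball_E: "cball x e \<subseteq> E" if "x \<in> C" for x
  proof
    fix z assume "z \<in> cball x e"
    then have "z = x + (z - x)" "z - x \<in> cball 0 e" by (auto simp: dist_norm norm_minus_commute)
    with that show "z \<in> E" unfolding E_def by blast
  qed
  have "compact E"
    unfolding E_def using C(1) by (intro compact_sums) auto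
  moreover have "E \<subseteq> D"
  proof
    fix z assume "z \<in> E"
    then obtain x y where "z = x + y" "x \<in> C" "norm y \<le> e" by (auto simp: E_def)
    then have "z \<in> cball x e" by (simp add: dist_norm)
    with e(2) \<open>x \<in> C\<close> show "z \<in> D" by blast
  qed
  ultimately have int: "set_integrable lebesgue E u"
    using L1_loc_set_integrable[OF L1 \<open>open D\<close>] by blast
  have "u x \<le> K / measure lebesgue (ball (0::'a) e) * (LINT y:E|lebesgue. u y)" if "x \<in> C" for x
  proof -
    have "u x \<le> K / measure lebesgue (ball x e) * (LINT y:ball x e|lebesgue. u y)"
      using sm e that unfolding quasi_submean_def by blast
    also have "measure lebesgue (ball x e) = measure lebesgue (ball (0::'a) e)"
      using measure_ball_scale[of e 1 x 0] e(1) by simp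
    also have "K / measure lebesgue (ball (0::'a) e) * (LINT y:ball x e|lebesgue. u y)
        \<le> K / measure lebesgue (ball (0::'a) e) * (LINT y:E|lebesgue. u y)"
      using cball_E[OF that] ball_subset_cball[of x e] \<open>E \<subseteq> D\<close> nonneg \<open>K \<ge> 0\<close>
      by (intro mult_left_mono set_integral_mono_subset[OF int]) auto
    finally show ?thesis .
  qed
  then show ?thesis by blast
qed

section \<open>Composition with permissible functions\<close>

lemma mono_on_borel_measurable_compose:
  fixes u :: "'a::euclidean_space \<Rightarrow> real" and \<phi> :: "real \<Rightarrow> real"
  assumes "mono_on {0..} \<phi>" "u \<in> borel_measurable (lebesgue_on D)" "\<And>x. x \<in> D \<Longrightarrow> 0 \<le> u x"
  shows "(\<lambda>x. \<phi> (u x)) \<in> borel_measurable (lebesgue_on D)"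
proof -
  have "mono (\<lambda>t. \<phi> (max t 0))"
    using assms(1) by (auto intro!: monoI simp: mono_on_def)
  then have [measurable]: "(\<lambda>t. \<phi> (max t 0)) \<in> borel_measurable borel"
    by (rule borel_measurable_mono)
  have "(\<lambda>x. \<phi> (max (u x) 0)) \<in> borel_measurable (lebesgue_on D)"
    by (rule measurable_compose[OF assms(2)]) simp
  then show ?thesis
    by (rule measurable_cong[THEN iffD1, rotated]) (use assms(3) in \<open>simp add: max_absorb1\<close>)
qed

text \<open>
  Monotone functions of a locally bounded function are locally bounded, which settles every
  question of integrability below.
\<close>
lemma mono_on_compose_L1_loc:
  fixes u :: "'a::euclidean_space \<Rightarrow> real" and \<phi> :: "real \<Rightarrow> real"
  assumes "mono_on {0..} \<phi>" "\<phi> \<in> {0..} \<rightarrow> {0..}"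
    and "u \<in> borel_measurable (lebesgue_on D)" "\<And>x. x \<in> D \<Longrightarrow> 0 \<le> u x"
    and bdd: "\<And>C. compact C \<Longrightarrow> C \<subseteq> D \<Longrightarrow> \<exists>B. \<forall>x\<in>C. u x \<le> B"
  shows "L1_loc D (\<lambda>x. ereal (\<phi> (u x)))"
    and "\<And>C. compact C \<Longrightarrow> C \<subseteq> D \<Longrightarrow> \<exists>B. \<forall>x\<in>C. \<phi> (u x) \<le> B"
proof -
  show *: "\<exists>B. \<forall>x\<in>C. \<phi> (u x) \<le> B" if C: "compact C" "C \<subseteq> D" for C
  proof -
    obtain B where B: "\<And>x. x \<in> C \<Longrightarrow> u x \<le> B"
      using bdd[OF C] by blast
    have "\<phi> (u x) \<le> \<phi> (max B 0)" if "x \<in> C" for x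
      using B[OF that] assms(4)[of x] C that by (intro mono_onD[OF assms(1)]) auto
    then show ?thesis by blast
  qed
  show "L1_loc D (\<lambda>x. ereal (\<phi> (u x)))"
  proof (rule locally_bounded_imp_L1_loc)
    fix C assume C: "compact C" "C \<subseteq> D"
    have "0 \<le> \<phi> (u x)" if "x \<in> C" for x
      using assms(2,4) C that by (auto simp: Pi_iff)
    then show "\<exists>B. \<forall>x\<in>C. \<bar>\<phi> (u x)\<bar> \<le> B"
      using *[OF C] by auto
  qed (use mono_on_borel_measurable_compose assms(1,3,4) in blast)
qed

lemma Delta2_scale:
  assumes "Delta2 \<phi>" "mono_on {0..} \<phi>" "\<phi> \<in> {0..} \<rightarrow> {0..}" "K \<ge> 0"
  obtains C where "C \<ge> 1" "\<And>t. t \<ge> 0 \<Longrightarrow> \<phi> (K * t) \<le> C * \<phi> t"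
proof -
  obtain C where C: "C \<ge> 1" "\<And>t. t \<ge> 0 \<Longrightarrow> \<phi> (2 * t) \<le> C * \<phi> t"
    using assms(1) by (auto simp: Delta2_def)
  have pow: "\<phi> (2 ^ n * t) \<le> C ^ n * \<phi> t" if "t \<ge> 0" for n t
  proof (induction n)
    case (Suc n)
    have "\<phi> (2 ^ Suc n * t) \<le> C * \<phi> (2 ^ n * t)"
      using C(2)[of "2 ^ n * t"] that by (simp add: mult.assoc)
    also have "\<dots> \<le> C * (C ^ n * \<phi> t)"
      using Suc C(1) by (intro mult_left_mono) auto
    finally show ?case by (simp add: mult.assoc)
  qed simp
  obtain n where n: "K \<le> 2 ^ n"
    using real_arch_pow[of 2 K] by (auto intro: less_imp_le)
  show thesis
  proof (rule that[of "C ^ n"])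
    show "1 \<le> C ^ n" using C(1) by (rule one_le_power)
    fix t :: real assume t: "t \<ge> 0"
    have "\<phi> (K * t) \<le> \<phi> (2 ^ n * t)"
      using n t \<open>K \<ge> 0\<close> by (intro mono_onD[OF assms(2)] mult_right_mono) auto
    with pow[OF t, of n] show "\<phi> (K * t) \<le> C ^ n * \<phi> t" by linarith
  qed
qed

text \<open>
  Jensen's inequality.  The constant extension to the negative half-line keeps \<open>\<phi>\<close> convex, so
  that a supporting line exists at the mean value even if this is \<open>0\<close>.
\<close>
lemma jensen_half_line:
  fixes f :: "'a \<Rightarrow> real"
  assumes cvx: "convex_on {0..} \<phi>" and mono: "mono_on {0..} \<phi>"
    and A: "A \<in> fmeasurable M" "measure M A > 0"
    and f: "set_integrable M A f" "\<And>x. x \<in> A \<Longrightarrow> 0 \<le> f x"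
    and \<phi>f: "set_integrable M A (\<lambda>x. \<phi> (f x))"
  shows "\<phi> ((LINT x:A|M. f x) / measure M A) \<le> (LINT x:A|M. \<phi> (f x)) / measure M A"
proof -
  define a where "a = (LINT x:A|M. f x) / measure M A"
  define q where "q = (\<lambda>t. \<phi> (max t 0))"
  have "0 \<le> (LINT x:A|M. f x)"
    by (rule set_integral_nonneg_on[OF f(2)])
  then have a: "a \<ge> 0" using A by (simp add: a_def)
  have "convex_on UNIV q"
  proof (rule convex_onI)
    fix t x y :: real assume t: "0 < t" "t < 1"
    have "max ((1 - t) * x + t * y) 0 \<le> (1 - t) * max x 0 + t * max y 0"
      using t by (intro max.boundedI add_mono mult_left_mono add_nonneg_nonneg) auto
    then have "q ((1 - t) * x + t * y) \<le> \<phi> ((1 - t) * max x 0 + t * max y 0)"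
      unfolding q_def using t by (intro mono_onD[OF mono]) auto
    also have "\<dots> \<le> (1 - t) * q x + t * q y"
      unfolding q_def using convex_onD[OF cvx, of t "max x 0" "max y 0"] t by simp
    finally show "q ((1 - t) *\<^sub>R x + t *\<^sub>R y) \<le> (1 - t) * q x + t * q y" by simp
  qed simp
  then obtain m where m: "\<And>t. q a + m * (t - a) \<le> q t"
    using convex_le_Inf_differential[of UNIV q a] by auto
  have line: "\<phi> a + m * (f x - a) \<le> \<phi> (f x)" if "x \<in> A" for x
    using m[of "f x"] f(2)[OF that] a by (simp add: q_def max_def)
  note const = set_integrable_const[OF A(1)]
  have intm: "set_integrable M A (\<lambda>x. m * (f x - a))"
    using f(1) const by (intro set_integrable_mult_right set_integral_diff) auto
  have "(LINT x:A|M. \<phi> a + m * (f x - a)) \<le> (LINT x:A|M. \<phi> (f x))"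
    using line const intm \<phi>f by (intro set_integral_mono set_integral_add) auto
  also have "(LINT x:A|M. \<phi> a + m * (f x - a)) = (LINT x:A|M. \<phi> a) + m * ((LINT x:A|M. f x) - (LINT x:A|M. a))"
    using const intm f(1) by (simp add: set_integral_add set_integral_diff)
  also have "\<dots> = \<phi> a * measure M A"
    using A by (simp add: a_def set_lebesgue_integral_def fmeasurableD)
  finally show ?thesis
    using A(2) by (simp add: a_def pos_le_divide_eq)
qed

lemma quasi_submean_convex:
  fixes u :: "'a::euclidean_space \<Rightarrow> real"
  assumes "open D" and nonneg: "\<And>x. x \<in> D \<Longrightarrow> 0 \<le> u x" and K: "K \<ge> 0"
    and L1: "L1_loc D (\<lambda>x. ereal (u x))" "L1_loc D (\<lambda>x. ereal (\<phi> (u x)))"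
    and sm: "quasi_submean K D u"
    and \<phi>: "convex_on {0..} \<phi>" "mono_on {0..} \<phi>" "\<phi> \<in> {0..} \<rightarrow> {0..}" "Delta2 \<phi>"
  shows "\<exists>K'\<ge>1. quasi_submean K' D (\<lambda>x. \<phi> (u x))"
proof -
  obtain C where C: "C \<ge> 1" "\<And>t. t \<ge> 0 \<Longrightarrow> \<phi> (K * t) \<le> C * \<phi> t"
    using Delta2_scale[OF \<phi>(4,2,3) K] by blast
  have "quasi_submean C D (\<lambda>x. \<phi> (u x))"
    unfolding quasi_submean_def
  proof (intro allI impI)
    fix x r assume *: "0 < r \<and> cball x r \<subseteq> D"
    let ?b = "measure lebesgue (ball x r)" and ?I = "LINT y:ball x r|lebesgue. u y"
    have b: "?b > 0" using * by (intro measure_ball_pos) simp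
    have int: "set_integrable lebesgue (ball x r) u" "set_integrable lebesgue (ball x r) (\<lambda>y. \<phi> (u y))"
      using L1_loc_set_integrable_ball[OF L1(1) \<open>open D\<close>] L1_loc_set_integrable_ball[OF L1(2) \<open>open D\<close>] * by auto
    have xD: "x \<in> D" using * by auto
    have nn: "0 \<le> u y" if "y \<in> ball x r" for y
      using * nonneg ball_subset_cball[of x r] that by blast
    have I: "0 \<le> ?I"
      by (rule set_integral_nonneg_on[OF nn])
    have "u x \<le> K * (?I / ?b)"
      using sm * by (simp add: quasi_submean_def)
    then have "\<phi> (u x) \<le> \<phi> (K * (?I / ?b))"
      using nonneg[OF xD] by (intro mono_onD[OF \<phi>(2)]) auto
    also have "\<dots> \<le> C * \<phi> (?I / ?b)"
      using I b by (intro C(2)) auto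
    also have "\<dots> \<le> C * ((LINT y:ball x r|lebesgue. \<phi> (u y)) / ?b)"
      using C(1) b int nn by (intro mult_left_mono jensen_half_line \<phi>) auto
    finally show "\<phi> (u x) \<le> C / ?b * (LINT y:ball x r|lebesgue. \<phi> (u y))" by simp
  qed
  with C(1) show ?thesis by blast
qed

text \<open>
  A passage from \<open>v\<close> to \<open>\<omega> \<circ> v\<close> where \<open>\<omega>\<close> grows at most linearly, as \<open>\<omega> t = t powr p\<close> with
  \<open>p < 1\<close> does, so that Jensen's inequality points the wrong way.  Choose \<open>y\<close> in the ball
  \<open>B = ball x r\<close> almost maximising \<open>(r - dist x y) ^ N * \<omega> (v y)\<close>.  On the ball about \<open>y\<close> whose
  radius is half the distance of \<open>y\<close> from the boundary of \<open>B\<close>, maximality bounds \<open>\<omega> \<circ> v\<close>, and hence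
  \<open>v\<close>, by a constant times the value at \<open>y\<close>; there quasi-decrease of \<open>\<omega> t / t\<close> converts the
  mean value of \<open>v\<close> into that of \<open>\<omega> \<circ> v\<close>.  The weight at \<open>x\<close> is \<open>r ^ N\<close>, so the
  resulting bound at \<open>y\<close> carries over to \<open>x\<close>.
\<close>
lemma quasi_submean_quasi_decreasing:
  fixes v :: "'a::euclidean_space \<Rightarrow> real"
  assumes "open D" and nonneg: "\<And>x. x \<in> D \<Longrightarrow> 0 \<le> v x" and K: "K \<ge> 0"
    and L1: "L1_loc D (\<lambda>x. ereal (v x))" "L1_loc D (\<lambda>x. ereal (\<omega> (v x)))"
    and bdd: "\<And>C. compact C \<Longrightarrow> C \<subseteq> D \<Longrightarrow> \<exists>B. \<forall>x\<in>C. \<omega> (v x) \<le> B"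
    and sm: "quasi_submean K D v"
    and \<omega>: "strict_mono_on {0..} \<omega>" "\<omega> ` {0..} = {0..}" "Delta2 (inv_into {0..} \<omega>)"
    and c: "c > 0" "\<And>s t. 0 < s \<Longrightarrow> s \<le> t \<Longrightarrow> c * (\<omega> t / t) \<le> \<omega> s / s"
  shows "\<exists>K'\<ge>1. quasi_submean K' D (\<lambda>x. \<omega> (v x))"
proof -
  let ?N = "DIM('a)" and ?\<theta> = "inv_into {0..} \<omega>"
  have inj: "inj_on \<omega> {0..}"
    using \<omega>(1) by (rule strict_mono_on_imp_inj_on)
  have inv: "?\<theta> (\<omega> t) = t" if "t \<ge> 0" for t
    using inj that by simp
  have \<omega>_nonneg: "0 \<le> \<omega> t" if "t \<ge> 0" for t
    using \<omega>(2) that by auto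
  have \<omega>_less: "\<omega> s < \<omega> t" if "0 \<le> s" "s < t" for s t
    using \<omega>(1) that by (auto simp: strict_mono_on_def)
  have \<omega>_mono: "\<omega> s \<le> \<omega> t" if "0 \<le> s" "s \<le> t" for s t
    using \<omega>_less[of s t] that by (cases "s = t") auto
  have \<omega>0: "\<omega> 0 = 0"
  proof -
    have "0 \<in> \<omega> ` {0..}" using \<omega>(2) by simp
    then obtain t where "0 = \<omega> t" "t \<ge> 0" by auto
    then show ?thesis using \<omega>_mono[of 0 t] \<omega>_nonneg[of 0] by simp
  qed
  have \<theta>_Pi: "?\<theta> \<in> {0..} \<rightarrow> {0..}"
    using \<omega>(2) inv_into_into[of _ \<omega> "{0..}"] by (auto simp del: atLeast_iff)
  have \<theta>_right: "\<omega> (?\<theta> s) = s" if "s \<ge> 0" for s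
    using that \<omega>(2) by (intro f_inv_into_f) auto
  have \<theta>_mono: "mono_on {0..} ?\<theta>"
  proof (rule mono_onI)
    fix s t :: real assume st: "s \<in> {0..}" "t \<in> {0..}" "s \<le> t"
    show "?\<theta> s \<le> ?\<theta> t"
    proof (rule ccontr)
      assume "\<not> ?\<theta> s \<le> ?\<theta> t"
      then have "\<omega> (?\<theta> t) < \<omega> (?\<theta> s)"
        using \<theta>_Pi st by (intro \<omega>_less) (auto simp: Pi_iff)
      then show False using st by (simp add: \<theta>_right)
    qed
  qed
  obtain L where L: "L \<ge> 1" "\<And>s. s \<ge> 0 \<Longrightarrow> ?\<theta> (2 ^ Suc ?N * s) \<le> L * ?\<theta> s"
    using Delta2_scale[OF \<omega>(3) \<theta>_mono \<theta>_Pi, of "2 ^ Suc ?N"] by auto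
  \<comment> \<open>One factor 2 is lost to the approximate maximum, the factor \<open>2 ^ N\<close> to the halved radius.\<close>
  define K' where "K' = 2 ^ Suc ?N * K * L / c"
  have K': "K' \<ge> 0" using K L(1) c(1) by (simp add: K'_def)
  have main: "\<omega> (v x) \<le> K' / measure lebesgue (ball x r) * (LINT y:ball x r|lebesgue. \<omega> (v y))"
    if r: "r > 0" and cb: "cball x r \<subseteq> D" for x r
  proof -
    let ?B = "ball x r" and ?w = "\<lambda>y. \<omega> (v y)"
    let ?I = "LINT y:?B|lebesgue. ?w y"
    have BD: "?B \<subseteq> D" and xD: "x \<in> D" using cb r by auto
    have w_nonneg: "0 \<le> ?w y" if "y \<in> D" for y
      using nonneg[OF that] by (rule \<omega>_nonneg)
    have intw: "set_integrable lebesgue ?B ?w"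
      using L1_loc_set_integrable_ball[OF L1(2) \<open>open D\<close> cb] .
    have b: "measure lebesgue ?B > 0" by (rule measure_ball_pos[OF r])
    have I: "0 \<le> ?I"
      using w_nonneg BD by (intro set_integral_nonneg_on) blast
    show ?thesis
    proof (cases "?w x = 0")
      case True
      then show ?thesis using I K' b by simp
    next
      case False
      then have wx: "?w x > 0" using w_nonneg[OF xD] by simp
      define g where "g = (\<lambda>y. (r - dist x y) ^ ?N * ?w y)"
      define S where "S = (SUP y\<in>?B. g y)"
      obtain W where W: "\<And>y. y \<in> cball x r \<Longrightarrow> ?w y \<le> W"
        using bdd[OF compact_cball cb] by blast
      have "g y \<le> r ^ ?N * W" if "y \<in> ?B" for y
        unfolding g_def using that W[of y] w_nonneg[of y] BD r
        by (intro mult_mono power_mono) auto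
      then have bdd_g: "bdd_above (g ` ?B)" by (rule bdd_aboveI2)
      have g_le: "g y \<le> S" if "y \<in> ?B" for y
        unfolding S_def by (rule cSUP_upper[OF that bdd_g])
      have gx: "r ^ ?N * ?w x \<le> S"
        using g_le[of x] r by (simp add: g_def)
      moreover have "0 < r ^ ?N * ?w x" using r wx by simp
      ultimately have S: "S > 0" by linarith
      have "?B \<noteq> {}" using r by simp
      from less_cSUP_iff[OF this bdd_g, of "S / 2"] S
      obtain y where y: "y \<in> ?B" "S / 2 < g y"
        unfolding S_def[symmetric] by auto
      define d where "d = r - dist x y"
      have d: "d > 0" using y(1) by (simp add: d_def)
      have yD: "y \<in> D" using y(1) BD by auto
      have Sy: "S < 2 * d ^ ?N * ?w y"
        using y(2) by (simp add: g_def d_def)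
      have "?w y \<noteq> 0" using Sy S by auto
      then have wy: "?w y > 0" using w_nonneg[OF yD] by simp
      then have "v y \<noteq> 0" using \<omega>0 by auto
      then have vy: "v y > 0" using nonneg[OF yD] by simp
      have near: "cball y (d / 2) \<subseteq> ?B"
      proof
        fix z assume "z \<in> cball y (d / 2)"
        then show "z \<in> ?B" using dist_triangle[of x z y] d by (simp add: d_def)
      qed
      have ball_near: "ball y (d / 2) \<subseteq> ?B" using near ball_subset_cball by blast
      have v_le: "v z \<le> L * v y" if z: "z \<in> ball y (d / 2)" for z
      proof -
        have zB: "z \<in> ?B" and zD: "z \<in> D" using z ball_near BD by auto
        have "d / 2 \<le> r - dist x z"
          using dist_triangle[of x z y] z by (simp add: d_def)
        then have "(d / 2) ^ ?N * ?w z \<le> g z"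
          unfolding g_def using d w_nonneg[OF zD] by (intro mult_right_mono power_mono) auto
        also have "\<dots> \<le> 2 * d ^ ?N * ?w y"
          using g_le[OF zB] Sy by linarith
        finally have "?w z \<le> 2 ^ Suc ?N * ?w y"
          using d by (simp add: field_simps)
        then have "?\<theta> (?w z) \<le> ?\<theta> (2 ^ Suc ?N * ?w y)"
          using w_nonneg zD yD by (intro mono_onD[OF \<theta>_mono]) auto
        also have "\<dots> \<le> L * ?\<theta> (?w y)"
          using wy by (intro L(2)) simp
        finally show ?thesis
          using inv nonneg zD yD by simp
      qed
      define t where "t = L * v y"
      have t: "t > 0" using L(1) vy by (simp add: t_def)
      have compare: "c * \<omega> t * v z \<le> t * ?w z" if z: "z \<in> ball y (d / 2)" for z
      proof (cases "v z = 0")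
        case False
        then have "v z > 0" using nonneg[of z] subsetD[OF BD subsetD[OF ball_near z]] by simp
        then show ?thesis
          using c(2)[of "v z" t] v_le[OF z] t by (simp add: t_def[symmetric] field_simps)
      qed (simp add: \<omega>0)
      let ?b' = "measure lebesgue (ball y (d / 2))"
      have b': "?b' > 0" using d by (intro measure_ball_pos) simp
      have yr: "cball y (d / 2) \<subseteq> D" using near BD by blast
      have intv: "set_integrable lebesgue (ball y (d / 2)) v"
        and intw': "set_integrable lebesgue (ball y (d / 2)) ?w"
        using L1_loc_set_integrable_ball[OF L1(1) \<open>open D\<close> yr]
          L1_loc_set_integrable_ball[OF L1(2) \<open>open D\<close> yr] .
      have "c * \<omega> t * (LINT z:ball y (d / 2)|lebesgue. v z) = (LINT z:ball y (d / 2)|lebesgue. c * \<omega> t * v z)"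
        by simp
      also have "\<dots> \<le> (LINT z:ball y (d / 2)|lebesgue. t * ?w z)"
        using compare intv intw' by (intro set_integral_mono set_integrable_mult_right) auto
      also have "\<dots> = t * (LINT z:ball y (d / 2)|lebesgue. ?w z)" by simp
      also have "\<dots> \<le> t * ?I"
        using ball_near w_nonneg BD t by (intro mult_left_mono set_integral_mono_subset[OF intw]) auto
      finally have J: "c * \<omega> t * (LINT z:ball y (d / 2)|lebesgue. v z) \<le> t * ?I" .
      have "v y \<le> K / ?b' * (LINT z:ball y (d / 2)|lebesgue. v z)"
        using sm yr d by (simp add: quasi_submean_def)
      then have "c * \<omega> t * v y \<le> c * \<omega> t * (K / ?b' * (LINT z:ball y (d / 2)|lebesgue. v z))"
        using c(1) \<omega>_nonneg[of t] t by (intro mult_left_mono) auto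
      also have "\<dots> = K / ?b' * (c * \<omega> t * (LINT z:ball y (d / 2)|lebesgue. v z))" by simp
      also have "\<dots> \<le> K / ?b' * (t * ?I)"
        using J K b' by (intro mult_left_mono) auto
      finally have "(c * \<omega> t) * v y \<le> (K * L / ?b' * ?I) * v y"
        by (simp add: t_def mult_ac)
      then have ct: "c * \<omega> t \<le> K * L / ?b' * ?I"
        using vy by (rule mult_right_le_imp_le)
      have "v y \<le> t" using L(1) vy by (simp add: t_def mult_le_cancel_right1)
      then have "c * ?w y \<le> c * \<omega> t"
        using c(1) vy by (intro mult_left_mono \<omega>_mono) auto
      with ct have "?w y * c \<le> K * L / ?b' * ?I" by (simp only: mult.commute[of _ c])
      then have "?w y \<le> (K * L / ?b' * ?I) / c"
        using c(1) by (simp only: pos_le_divide_eq)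
      also have "\<dots> = K * L / c / ?b' * ?I" by simp
      finally have "?w y \<le> K * L / c / ?b' * ?I" .
      then have "2 * d ^ ?N * ?w y \<le> 2 * d ^ ?N * (K * L / c / ?b' * ?I)"
        using d by (intro mult_left_mono) auto
      with gx Sy have "r ^ ?N * ?w x \<le> 2 * d ^ ?N * (K * L / c / ?b' * ?I)" by linarith
      also have "?b' = (d / (2 * r)) ^ ?N * measure lebesgue ?B"
        using measure_ball_scale[of r "d / (2 * r)" y x] d r by simp
      also have "2 * d ^ ?N * (K * L / c / ((d / (2 * r)) ^ ?N * measure lebesgue ?B) * ?I)
          = r ^ ?N * (K' / measure lebesgue ?B * ?I)"
        using d r b c(1) by (simp add: K'_def power_divide power_mult_distrib field_simps)
      finally show ?thesis
        by (rule mult_left_le_imp_le) (use r in simp)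
    qed
  qed
  have "quasi_submean (max 1 K') D (\<lambda>x. \<omega> (v x))"
    unfolding quasi_submean_def
  proof (intro allI impI)
    fix x r assume *: "0 < r \<and> cball x r \<subseteq> D"
    have "0 \<le> (LINT y:ball x r|lebesgue. \<omega> (v y))"
      using * nonneg \<omega>_nonneg ball_subset_cball[of x r] by (intro set_integral_nonneg_on) blast
    then have "K' / measure lebesgue (ball x r) * (LINT y:ball x r|lebesgue. \<omega> (v y))
        \<le> max 1 K' / measure lebesgue (ball x r) * (LINT y:ball x r|lebesgue. \<omega> (v y))"
      by (intro mult_right_mono divide_right_mono) auto
    with main[of r x] * show "\<omega> (v x) \<le> max 1 K' / measure lebesgue (ball x r) * (LINT y:ball x r|lebesgue. \<omega> (v y))"
      by linarith
  qed
  then show ?thesis by (intro exI[of _ "max 1 K'"]) simp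
qed

theorem quasi_nearly_subharmonic_permissible_compose:
  fixes u :: "'a::euclidean_space \<Rightarrow> real"
  assumes "open D" and nonneg: "\<And>x. x \<in> D \<Longrightarrow> 0 \<le> u x"
    and qns: "quasi_nearly_subharmonic D (\<lambda>x. ereal (u x))" and \<psi>: "permissible \<psi>"
  shows "quasi_nearly_subharmonic D (\<lambda>x. ereal (\<psi> (u x)))"
proof -
  obtain K where K: "K \<ge> 1" "K_quasi_nearly_subharmonic K D (\<lambda>x. ereal (u x))"
    using qns by (auto simp: quasi_nearly_subharmonic_def)
  then have "K_quasi_nearly_subharmonic_ns K D (\<lambda>x. ereal (u x))"
    using quasi_nearly_subharmonic_iff_narrow_sense[of D u K] nonneg by simp
  then have L1: "L1_loc D (\<lambda>x. ereal (u x))" and sm: "quasi_submean K D u"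
    using narrow_sense_iff_quasi_submean[OF \<open>open D\<close> nonneg, where K = K] by simp_all
  obtain \<psi>1 \<psi>2 c where
    \<psi>1: "\<psi>1 \<in> {0..} \<rightarrow> {0..}" "mono_on {0..} \<psi>1" "convex_on {0..} \<psi>1" "Delta2 \<psi>1"
    and \<psi>2: "strict_mono_on {0..} \<psi>2" "\<psi>2 ` {0..} = {0..}" "Delta2 (inv_into {0..} \<psi>2)"
    and \<psi>_eq: "\<And>t. t \<ge> 0 \<Longrightarrow> \<psi> t = \<psi>2 (\<psi>1 t)"
    and c: "c > 0" "\<And>s t. 0 < s \<Longrightarrow> s \<le> t \<Longrightarrow> c * (\<psi>2 t / t) \<le> \<psi>2 s / s"
    using \<psi> unfolding permissible_def by auto
  have meas: "u \<in> borel_measurable (lebesgue_on D)"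
    using L1 borel_measurable_ereal_iff by (auto simp: L1_loc_def)
  have bdd: "\<exists>B. \<forall>x\<in>C. u x \<le> B" if "compact C" "C \<subseteq> D" for C
    using quasi_submean_locally_bounded[OF \<open>open D\<close> nonneg _ L1 sm that] K(1) by auto
  define v where "v = (\<lambda>x. \<psi>1 (u x))"
  have v_nonneg: "0 \<le> v x" if "x \<in> D" for x
    using \<psi>1(1) nonneg[OF that] by (auto simp: v_def)
  have v_meas: "v \<in> borel_measurable (lebesgue_on D)"
    unfolding v_def by (rule mono_on_borel_measurable_compose[OF \<psi>1(2) meas nonneg])
  have v_L1: "L1_loc D (\<lambda>x. ereal (v x))"
    and v_bdd: "\<And>C. compact C \<Longrightarrow> C \<subseteq> D \<Longrightarrow> \<exists>B. \<forall>x\<in>C. v x \<le> B"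
    unfolding v_def using mono_on_compose_L1_loc[OF \<psi>1(2,1) meas nonneg bdd] by blast+
  obtain K1 where K1: "K1 \<ge> 1" "quasi_submean K1 D v"
    using quasi_submean_convex[OF \<open>open D\<close> nonneg _ L1 v_L1[unfolded v_def] sm \<psi>1(3,2,1,4)] K(1)
    by (auto simp: v_def)
  have \<psi>2_mono: "mono_on {0..} \<psi>2"
    using \<psi>2(1) by (rule strict_mono_on_imp_mono_on)
  have \<psi>2_Pi: "\<psi>2 \<in> {0..} \<rightarrow> {0..}"
    using \<psi>2(2) by auto
  have w_L1: "L1_loc D (\<lambda>x. ereal (\<psi>2 (v x)))"
    and w_bdd: "\<And>C. compact C \<Longrightarrow> C \<subseteq> D \<Longrightarrow> \<exists>B. \<forall>x\<in>C. \<psi>2 (v x) \<le> B"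
    using mono_on_compose_L1_loc[OF \<psi>2_mono \<psi>2_Pi v_meas v_nonneg v_bdd] by blast+
  obtain K2 where K2: "K2 \<ge> 1" "quasi_submean K2 D (\<lambda>x. \<psi>2 (v x))"
    using quasi_submean_quasi_decreasing[OF \<open>open D\<close> v_nonneg _ v_L1 w_L1 w_bdd K1(2) \<psi>2 c] K1(1) by auto
  have eq: "\<psi> (u x) = \<psi>2 (v x)" if "x \<in> D" for x
    using \<psi>_eq nonneg[OF that] by (simp add: v_def)
  have "L1_loc D (\<lambda>x. ereal (\<psi> (u x)))"
  proof (rule locally_bounded_imp_L1_loc)
    have "(\<lambda>x. \<psi>2 (v x)) \<in> borel_measurable (lebesgue_on D)"
      by (rule mono_on_borel_measurable_compose[OF \<psi>2_mono v_meas v_nonneg])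
    then show "(\<lambda>x. \<psi> (u x)) \<in> borel_measurable (lebesgue_on D)"
      by (rule measurable_cong[THEN iffD1, rotated]) (simp add: eq)
    fix C assume C: "compact C" "C \<subseteq> D"
    then obtain B where "\<forall>x\<in>C. \<psi>2 (v x) \<le> B" using w_bdd by blast
    moreover have "\<bar>\<psi> (u x)\<bar> = \<psi>2 (v x)" if "x \<in> C" for x
      using eq[of x] C that \<psi>2_Pi v_nonneg[of x] by (auto simp: Pi_iff)
    ultimately show "\<exists>B. \<forall>x\<in>C. \<bar>\<psi> (u x)\<bar> \<le> B" by auto
  qed
  moreover have "quasi_submean K2 D (\<lambda>x. \<psi> (u x))"
    unfolding quasi_submean_def
  proof (intro allI impI)
    fix x r assume *: "0 < r \<and> cball x r \<subseteq> D"
    then have "x \<in> D" "ball x r \<subseteq> D" by auto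
    then have "(LINT y:ball x r|lebesgue. \<psi> (u y)) = (LINT y:ball x r|lebesgue. \<psi>2 (v y))"
      using eq by (intro set_lebesgue_integral_cong) auto
    then show "\<psi> (u x) \<le> K2 / measure lebesgue (ball x r) * (LINT y:ball x r|lebesgue. \<psi> (u y))"
      using K2(2) * eq[OF \<open>x \<in> D\<close>] by (simp add: quasi_submean_def)
  qed
  moreover have "0 \<le> \<psi> (u x)" if "x \<in> D" for x
    using eq[OF that] \<psi>2_Pi v_nonneg[OF that] by auto
  ultimately show ?thesis
    by (intro quasi_nearly_subharmonicI[OF \<open>open D\<close> _ K2(1)])
qed

section \<open>Harnack functions\<close>

text \<open>
  On the ball of radius \<open>l * r\<close> every value of \<open>u\<close> is at least \<open>u x / C\<close>; enlarging the ball to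
  radius \<open>r\<close> costs the factor \<open>l ^ N\<close> in the volume.
\<close>

theorem Harnack_function_quasi_nearly_subharmonic:
  fixes u :: "'a::euclidean_space \<Rightarrow> real"
  assumes "open D" and H: "Harnack_function D u"
  shows "quasi_nearly_subharmonic D (\<lambda>x. ereal (u x))"
proof -
  let ?N = "DIM('a)"
  have cont: "continuous_on D u" and nonneg: "\<And>x. x \<in> D \<Longrightarrow> 0 \<le> u x"
    using H by (auto simp: Harnack_function_def)
  obtain l C where l: "0 < l" "l < 1" and C: "C \<ge> 1"
    and Harnack: "\<forall>x r. r > 0 \<and> cball x r \<subseteq> D \<longrightarrow>
      (SUP y\<in>cball x (l * r). u y) \<le> C * (INF y\<in>cball x (l * r). u y)"
    using H unfolding Harnack_function_def by (elim conjE exE)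
  have bdd: "bounded (u ` S)" if "compact S" "S \<subseteq> D" for S
    using compact_imp_bounded[OF compact_continuous_image[OF continuous_on_subset[OF cont that(2)] that(1)]] .
  have L1: "L1_loc D (\<lambda>x. ereal (u x))"
  proof (rule locally_bounded_imp_L1_loc)
    show "u \<in> borel_measurable (lebesgue_on D)"
      using cont \<open>open D\<close> by (intro continuous_imp_measurable_on_sets_lebesgue) auto
    show "\<exists>B. \<forall>x\<in>S. \<bar>u x\<bar> \<le> B" if "compact S" "S \<subseteq> D" for S
      using bdd[OF that] by (auto simp: bounded_iff)
  qed
  define K where "K = C / l ^ ?N"
  have "l ^ ?N \<le> 1" using l by (intro power_le_one) auto
  then have K: "K \<ge> 1" using C l by (simp add: K_def field_simps)
  have "quasi_submean K D u"
    unfolding quasi_submean_def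
  proof (intro allI impI)
    fix x r assume *: "0 < r \<and> cball x r \<subseteq> D"
    then have r: "r > 0" and cb: "cball x r \<subseteq> D" by auto
    let ?b = "measure lebesgue (ball x r)" and ?b' = "measure lebesgue (ball x (l * r))"
    have sub: "cball x (l * r) \<subseteq> cball x r"
      using l r by (intro subset_cball) (simp add: mult_le_cancel_right1)
    have b: "?b > 0" by (rule measure_ball_pos[OF r])
    have bd: "bounded (u ` cball x (l * r))"
      using sub cb by (intro bdd) auto
    have pw: "u x \<le> C * u y" if "y \<in> ball x (l * r)" for y
    proof -
      have "u x \<le> (SUP y\<in>cball x (l * r). u y)"
        using l r bd by (intro cSUP_upper bounded_imp_bdd_above) auto
      also have "\<dots> \<le> C * (INF y\<in>cball x (l * r). u y)"
        using Harnack r cb by simp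
      also have "\<dots> \<le> C * u y"
        using that C bd by (intro mult_left_mono cINF_lower bounded_imp_bdd_below) auto
      finally show ?thesis .
    qed
    have int: "set_integrable lebesgue (ball x r) u"
      using L1_loc_set_integrable_ball[OF L1 \<open>open D\<close> cb] .
    have ball_sub: "ball x (l * r) \<subseteq> ball x r"
      using l r by (intro subset_ball) (simp add: mult_le_cancel_right1)
    then have int': "set_integrable lebesgue (ball x (l * r)) u"
      by (rule set_integrable_subset[OF int, rotated]) auto
    have "u x * ?b' = (LINT y:ball x (l * r)|lebesgue. u x)"
      by (simp add: set_lebesgue_integral_def)
    also have "\<dots> \<le> (LINT y:ball x (l * r)|lebesgue. C * u y)"
      using pw int' by (intro set_integral_mono set_integrable_mult_right set_integrable_const) auto
    also have "\<dots> = C * (LINT y:ball x (l * r)|lebesgue. u y)" by simp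
    also have "\<dots> \<le> C * (LINT y:ball x r|lebesgue. u y)"
    proof (intro mult_left_mono set_integral_mono_subset[OF int])
      show "0 \<le> u y" if "y \<in> ball x r" for y
        using nonneg cb ball_subset_cball[of x r] that by blast
    qed (use C ball_sub in auto)
    also have "?b' = l ^ ?N * ?b"
      by (rule measure_ball_scale[OF r l(1)])
    finally show "u x \<le> K / ?b * (LINT y:ball x r|lebesgue. u y)"
      using b l by (simp add: K_def field_simps)
  qed
  then show ?thesis
    using nonneg by (intro quasi_nearly_subharmonicI[OF \<open>open D\<close> _ K L1])
qed

section \<open>Comparison of the classes\<close>

theorem proposition1:
  fixes D :: "(real ^ 'n) set" and K :: real
  assumes "CARD('n) \<ge> 2"
    and "open D" "connected D" "D \<noteq> {}"
    and "K \<ge> 1"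
  shows
    "(\<forall>u :: real ^ 'n \<Rightarrow> real.
        (\<forall>x\<in>D. u x \<ge> 0) \<and> u \<in> borel_measurable (lebesgue_on D) \<and> L1_loc D (\<lambda>x. ereal (u x)) \<longrightarrow>
          (K_quasi_nearly_subharmonic K D (\<lambda>x. ereal (u x))
             \<longleftrightarrow> K_quasi_nearly_subharmonic_ns K D (\<lambda>x. ereal (u x))) \<and>
          (K_quasi_nearly_subharmonic_ns K D (\<lambda>x. ereal (u x))
             \<longleftrightarrow> (\<forall>x r. r > 0 \<and> cball x r \<subseteq> D \<longrightarrow>
                   u x \<le> K / (ball_const TYPE(real ^ 'n) * r ^ CARD('n)) *
                          (LINT y:ball x r|lebesgue. u y))))
     \<and>
     ((\<forall>u :: real ^ 'n \<Rightarrow> ereal.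
         K_quasi_nearly_subharmonic_ns K D u \<longrightarrow> K_quasi_nearly_subharmonic K D u) \<and>
      (K > 1 \<longrightarrow>
         (\<exists>u :: real ^ 'n \<Rightarrow> ereal.
            K_quasi_nearly_subharmonic K D u \<and> \<not> K_quasi_nearly_subharmonic_ns K D u)))
     \<and>
     (\<forall>u :: real ^ 'n \<Rightarrow> ereal.
        (K_quasi_nearly_subharmonic 1 D u \<longleftrightarrow> nearly_subharmonic D u) \<and>
        (nearly_subharmonic D u \<longleftrightarrow> K_quasi_nearly_subharmonic_ns 1 D u))
     \<and>
     (\<forall>(u :: real ^ 'n \<Rightarrow> real) \<psi>.
        (\<forall>x\<in>D. u x \<ge> 0) \<and> quasi_nearly_subharmonic D (\<lambda>x. ereal (u x)) \<and> permissible \<psi> \<longrightarrow>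
          quasi_nearly_subharmonic D (\<lambda>x. ereal ((\<psi> \<circ> u) x)))
     \<and>
     (\<forall>u :: real ^ 'n \<Rightarrow> real.
        Harnack_function D u \<longrightarrow> quasi_nearly_subharmonic D (\<lambda>x. ereal (u x)))"
proof (intro conjI allI impI)
  fix u :: "real ^ 'n \<Rightarrow> real"
  assume u: "(\<forall>x\<in>D. u x \<ge> 0) \<and> u \<in> borel_measurable (lebesgue_on D) \<and> L1_loc D (\<lambda>x. ereal (u x))"
  then have nonneg: "\<And>x. x \<in> D \<Longrightarrow> 0 \<le> u x" by blast
  show "K_quasi_nearly_subharmonic K D (\<lambda>x. ereal (u x))
      \<longleftrightarrow> K_quasi_nearly_subharmonic_ns K D (\<lambda>x. ereal (u x))"
    by (rule quasi_nearly_subharmonic_iff_narrow_sense[OF nonneg \<open>K \<ge> 1\<close>])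
  have const: "measure lebesgue (ball x r) = ball_const TYPE(real ^ 'n) * r ^ CARD('n)"
    if "r > 0" for x :: "real ^ 'n" and r
    using ball_const_mult_power[OF that, of x] by simp
  have "quasi_submean K D u \<longleftrightarrow> (\<forall>x r. r > 0 \<and> cball x r \<subseteq> D \<longrightarrow>
      u x \<le> K / (ball_const TYPE(real ^ 'n) * r ^ CARD('n)) * (LINT y:ball x r|lebesgue. u y))"
    unfolding quasi_submean_def by (intro iff_allI imp_cong refl) (simp only: const)
  then show "K_quasi_nearly_subharmonic_ns K D (\<lambda>x. ereal (u x)) \<longleftrightarrow>
      (\<forall>x r. r > 0 \<and> cball x r \<subseteq> D \<longrightarrow>
         u x \<le> K / (ball_const TYPE(real ^ 'n) * r ^ CARD('n)) * (LINT y:ball x r|lebesgue. u y))"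
    using narrow_sense_iff_quasi_submean[OF \<open>open D\<close> nonneg, where K = K] u by simp
next
  fix u :: "real ^ 'n \<Rightarrow> ereal"
  assume "K_quasi_nearly_subharmonic_ns K D u"
  then show "K_quasi_nearly_subharmonic K D u"
    using \<open>K \<ge> 1\<close> by (rule narrow_sense_imp_quasi_nearly_subharmonic)
next
  assume "K > 1"
  then show "\<exists>u :: real ^ 'n \<Rightarrow> ereal.
      K_quasi_nearly_subharmonic K D u \<and> \<not> K_quasi_nearly_subharmonic_ns K D u"
    using quasi_nearly_subharmonic_not_narrow_sense \<open>open D\<close> \<open>D \<noteq> {}\<close> by blast
next
  fix u :: "real ^ 'n \<Rightarrow> ereal"
  show "K_quasi_nearly_subharmonic 1 D u \<longleftrightarrow> nearly_subharmonic D u"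
    using one_quasi_nearly_subharmonic_imp_nearly_subharmonic
      narrow_sense_imp_quasi_nearly_subharmonic[of 1 D u] nearly_subharmonic_iff_narrow_sense by auto
  show "nearly_subharmonic D u \<longleftrightarrow> K_quasi_nearly_subharmonic_ns 1 D u"
    by (rule nearly_subharmonic_iff_narrow_sense)
next
  fix u :: "real ^ 'n \<Rightarrow> real" and \<psi>
  assume "(\<forall>x\<in>D. u x \<ge> 0) \<and> quasi_nearly_subharmonic D (\<lambda>x. ereal (u x)) \<and> permissible \<psi>"
  then show "quasi_nearly_subharmonic D (\<lambda>x. ereal ((\<psi> \<circ> u) x))"
    using quasi_nearly_subharmonic_permissible_compose[OF \<open>open D\<close>, of u \<psi>] by auto
next
  fix u :: "real ^ 'n \<Rightarrow> real"
  assume "Harnack_function D u"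
  then show "quasi_nearly_subharmonic D (\<lambda>x. ereal (u x))"
    by (rule Harnack_function_quasi_nearly_subharmonic[OF \<open>open D\<close>])
qed

end
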